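(* Let $T$ be a tree and let $l\colon V(T)\to[0,\infty)$ be a non-degenerate labeling. Then the following are equivalent: (1) the ultrametric space $(V(T), d_l)$ is discrete and totally bounded; (2) $T$ is locally finite and for every $\varepsilon>0$ the set $V_\varepsilon=\{v\in V(T)\colon l(v)\ge\varepsilon\}$ is finite.
   Context: A tree is a connected acyclic graph with nonempty vertex set; it is locally finite if every vertex has finitely many adjacent vertices. For a labeling $l\colon V(T)\to[0,\infty)$ define $d_l(u,u)=0$ and, for $u\neq v$, $d_l(u,v)=\max_{w\in V(P)} l(w)$, where $P$ is the unique path joining $u$ and $v$ in $T$. The labeling is non-degenerate if $\max\{l(u),l(v)\}>0$ for every edge $\{u,v\}$; then $d_l$ is an ultrametric. A metric space is discrete if all its points are isolated. *)

theory Defs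
  imports "HOL-Analysis.Analysis"
begin

text \<open>
  Graphs are simple undirected graphs, possibly infinite, given by a vertex set \<open>V\<close> and a set
  \<open>E\<close> of two-element subsets of \<open>V\<close>.
\<close>

definition simple_graph :: "'a set \<Rightarrow> 'a set set \<Rightarrow> bool" where
  "simple_graph V E \<longleftrightarrow> (\<forall>e\<in>E. \<exists>u\<in>V. \<exists>v\<in>V. u \<noteq> v \<and> e = {u, v})"

text \<open>
  Paths are nonempty lists of pairwise distinct vertices, so the one-vertex path is allowed.
\<close>

definition graph_path :: "'a set \<Rightarrow> 'a set set \<Rightarrow> 'a list \<Rightarrow> bool" where
  "graph_path V E p \<longleftrightarrow>
     p \<noteq> [] \<and> set p \<subseteq> V \<and> distinct p \<and> successively (\<lambda>u v. {u, v} \<in> E) p"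

definition joins :: "'a set \<Rightarrow> 'a set set \<Rightarrow> 'a \<Rightarrow> 'a list \<Rightarrow> 'a \<Rightarrow> bool" where
  "joins V E u p v \<longleftrightarrow> graph_path V E p \<and> hd p = u \<and> last p = v"

definition graph_connected :: "'a set \<Rightarrow> 'a set set \<Rightarrow> bool" where
  "graph_connected V E \<longleftrightarrow> (\<forall>u\<in>V. \<forall>v\<in>V. \<exists>p. joins V E u p v)"

definition graph_cycle :: "'a set \<Rightarrow> 'a set set \<Rightarrow> 'a list \<Rightarrow> bool" where
  "graph_cycle V E p \<longleftrightarrow> graph_path V E p \<and> 3 \<le> length p \<and> {last p, hd p} \<in> E"

definition is_tree :: "'a set \<Rightarrow> 'a set set \<Rightarrow> bool" where
  "is_tree V E \<longleftrightarrow>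
     simple_graph V E \<and> V \<noteq> {} \<and> graph_connected V E \<and> \<not> (\<exists>p. graph_cycle V E p)"

definition locally_finite_graph :: "'a set \<Rightarrow> 'a set set \<Rightarrow> bool" where
  "locally_finite_graph V E \<longleftrightarrow> (\<forall>v\<in>V. finite {u \<in> V. {u, v} \<in> E})"

definition nondegenerate_labeling :: "'a set set \<Rightarrow> ('a \<Rightarrow> real) \<Rightarrow> bool" where
  "nondegenerate_labeling E l \<longleftrightarrow> (\<forall>u v. {u, v} \<in> E \<longrightarrow> max (l u) (l v) > 0)"

text \<open>
  The distance \<open>d\<^sub>l\<close> of a labeled tree. The locale \<open>Metric_space\<close> asks for symmetry and
  nonnegativity on the whole type, not only on the carrier; hence the value \<open>0\<close> when one of the
  arguments is not a vertex.
\<close>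

definition label_dist :: "'a set \<Rightarrow> 'a set set \<Rightarrow> ('a \<Rightarrow> real) \<Rightarrow> 'a \<Rightarrow> 'a \<Rightarrow> real" where
  "label_dist V E l u v =
     (if u = v \<or> u \<notin> V \<or> v \<notin> V then 0
      else Max (l ` set (THE p. joins V E u p v)))"

text \<open>
  Every point is isolated. The library's \<open>discrete\<close> concerns subsets of a type-class topological
  space, not an abstract metric space with a carrier.
\<close>

definition discrete_metric_space :: "'a set \<Rightarrow> ('a \<Rightarrow> 'a \<Rightarrow> real) \<Rightarrow> bool" where
  "discrete_metric_space M d \<longleftrightarrow> (\<forall>x\<in>M. \<exists>r>0. Metric_space.mball M d x r = {x})"

end

(* A path is contained in every walk with the same ends, because walks shorten to paths and paths
   in a tree are unique; so a bound on the labels along any walk bounds the distance of its ends,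
   which yields the strong triangle inequality.
   From (1) to (2): a vertex of label at least \<epsilon> lies in no \<epsilon>-ball around another point, hence
   belongs to every \<epsilon>-net.  Neighbours of v lie at mutual distance at least l v, so if l v > 0 then
   a finite (l v)-net bounds their number; if l v = 0, then isolation of v bounds their labels from
   below.
   From (2) to (1): the vertices of label at least \<epsilon>, their neighbours and one root form a finite
   \<epsilon>-net, as one sees by following the path from a vertex to the root. *)

theory Submission
  imports Defs
begin

section \<open>Walks and paths\<close>

text \<open>Without \<open>distinct\<close>, concatenation stays inside the notion; paths are
  recovered by shortening.\<close>

definition walk :: "'a set \<Rightarrow> 'a set set \<Rightarrow> 'a \<Rightarrow> 'a list \<Rightarrow> 'a \<Rightarrow> bool" where
  "walk V E u p v \<longleftrightarrow>
     p \<noteq> [] \<and> set p \<subseteq> V \<and> successively (\<lambda>u v. {u, v} \<in> E) p \<and> hd p = u \<and> last p = v"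

lemma joins_iff_walk: "joins V E u p v \<longleftrightarrow> walk V E u p v \<and> distinct p"
  by (auto simp: joins_def graph_path_def walk_def)

lemma walk_ends: "walk V E u p v \<Longrightarrow> u \<in> set p \<and> v \<in> set p"
  by (auto simp: walk_def)

lemma walk_subset: "walk V E u p v \<Longrightarrow> set p \<subseteq> V"
  by (simp add: walk_def)

lemma walk_singleton [simp]: "walk V E u [x] v \<longleftrightarrow> x \<in> V \<and> u = x \<and> v = x"
  by (auto simp: walk_def)

lemma walk_Cons:
  "p \<noteq> [] \<Longrightarrow> walk V E u (x # p) v \<longleftrightarrow> x \<in> V \<and> u = x \<and> {x, hd p} \<in> E \<and> walk V E (hd p) p v"
  by (auto simp: walk_def successively_Cons)

lemma walk_rev: "walk V E u p v \<Longrightarrow> walk V E v (rev p) u"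
  by (auto simp: walk_def hd_rev last_rev insert_commute)

text \<open>\<open>tl\<close> removes the second copy of the common end \<open>v\<close>.\<close>

lemma walk_append:
  assumes "walk V E u p v" "walk V E v q w"
  shows "walk V E u (p @ tl q) w"
proof -
  obtain q' where q: "q = v # q'"
    using assms(2) by (cases q) (auto simp: walk_def)
  show ?thesis
    using assms unfolding q
    by (cases "q' = []") (auto simp: walk_def successively_append_iff successively_Cons)
qed

lemma walk_suffix:
  assumes "walk V E u (p @ x # q) v"
  shows "walk V E x (x # q) v"
  using assms by (auto simp: walk_def successively_append_iff)

text \<open>Induction along the walk: put its first vertex in front of a path for the rest, or, if
  that path already visits this vertex, cut it to start there.\<close>

lemma walk_contains_path:
  assumes "walk V E u p v"
  shows "\<exists>q. joins V E u q v \<and> set q \<subseteq> set p"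
  using assms
proof (induction p arbitrary: u)
  case Nil
  then show ?case by (simp add: walk_def)
next
  case (Cons x p)
  show ?case
  proof (cases "p = []")
    case True
    with Cons.prems show ?thesis
      by (intro exI[of _ "[x]"]) (auto simp: joins_iff_walk)
  next
    case False
    then have w: "x \<in> V" "u = x" "{x, hd p} \<in> E" "walk V E (hd p) p v"
      using Cons.prems by (auto simp: walk_Cons)
    obtain q where q: "joins V E (hd p) q v" "set q \<subseteq> set p"
      using Cons.IH w(4) by blast
    show ?thesis
    proof (cases "x \<in> set q")
      case True
      then obtain q1 q2 where "q = q1 @ x # q2"
        by (meson split_list)
      with q w(2) walk_suffix[of V E "hd p" q1 x q2 v] show ?thesis
        by (intro exI[of _ "x # q2"]) (auto simp: joins_iff_walk)
    next
      case False
      have "q \<noteq> []" "hd q = hd p"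
        using q(1) by (auto simp: joins_def graph_path_def)
      with q w False show ?thesis
        by (intro exI[of _ "x # q"]) (auto simp: joins_iff_walk walk_Cons)
    qed
  qed
qed

text \<open>If the second vertices differ, following one path to \<open>v\<close> and the other back
  gives a walk between two neighbours of \<open>u\<close> that avoids \<open>u\<close>; a path
  within it closes to a cycle through \<open>u\<close>. If they agree, induct on the tails.\<close>

lemma acyclic_path_unique:
  assumes "\<nexists>p. graph_cycle V E p" "joins V E u p v" "joins V E u q v"
  shows "p = q"
  using assms(2,3)
proof (induction p arbitrary: u q)
  case Nil
  then show ?case by (simp add: joins_iff_walk walk_def)
next
  case (Cons x p)
  then obtain q' where q: "q = x # q'"
    by (cases q) (auto simp: joins_def graph_path_def)
  have dist: "x \<notin> set p" "distinct p" "x \<notin> set q'" "distinct q'"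
    using Cons.prems q by (auto simp: joins_iff_walk)
  show ?case
  proof (cases "p = [] \<or> q' = []")
    case True
    have "last (x # p) = last (x # q')"
      using Cons.prems q by (auto simp: joins_def)
    \<comment> \<open>One path ends at \<open>x\<close>, so the other does too, and distinctness
      allows no further vertex.\<close>
    with True dist have "p = []" "q' = []"
      by (metis last_ConsL last_ConsR last_in_set)+
    with q show ?thesis by simp
  next
    case False
    then have p: "x \<in> V" "{x, hd p} \<in> E" "walk V E (hd p) p v"
      and q': "{x, hd q'} \<in> E" "walk V E (hd q') q' v"
      using Cons.prems q by (auto simp: joins_iff_walk walk_Cons)
    have "hd p = hd q'"
    proof (rule ccontr)
      assume ne: "hd p \<noteq> hd q'"
      have "walk V E (hd p) (p @ tl (rev q')) (hd q')"
        using p(3) q'(2) walk_append walk_rev by metis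
      then obtain r where r: "joins V E (hd p) r (hd q')" "set r \<subseteq> set (p @ tl (rev q'))"
        using walk_contains_path by metis
      have "set (tl (rev q')) \<subseteq> set q'"
        by (metis False list.set_sel(2) rev_is_Nil_conv set_rev subsetI)
      with r(2) dist have "x \<notin> set r" by auto
      have ends: "r \<noteq> []" "hd r = hd p" "last r = hd q'"
        using r(1) by (auto simp: joins_def graph_path_def)
      \<comment> \<open>With \<open>x\<close> in front this makes the three vertices that
        \<open>graph_cycle\<close> demands.\<close>
      with ne have "length r \<ge> 2"
        by (cases r) (auto simp: Suc_le_eq)
      moreover have "joins V E x (x # r) (hd q')"
        using r(1) p(1,2) ends \<open>x \<notin> set r\<close> by (auto simp: joins_iff_walk walk_Cons)
      ultimately have "graph_cycle V E (x # r)"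
        using q'(1) ends by (auto simp: graph_cycle_def joins_def insert_commute)
      with assms(1) show False by blast
    qed
    moreover have "joins V E (hd p) p v" "joins V E (hd q') q' v"
      using p q' dist by (auto simp: joins_iff_walk)
    ultimately show ?thesis
      using Cons.IH q by metis
  qed
qed

section \<open>The ultrametric of a labeled tree\<close>

locale labeled_tree =
  fixes V :: "'a set" and E :: "'a set set" and l :: "'a \<Rightarrow> real"
  assumes tree: "is_tree V E"
    and label_nonneg: "v \<in> V \<Longrightarrow> 0 \<le> l v"
    and nondeg: "nondegenerate_labeling E l"
begin

abbreviation d where "d \<equiv> label_dist V E l"

lemma edgeD:
  assumes "{u, v} \<in> E"
  shows "u \<in> V" "v \<in> V" "u \<noteq> v"
proof -
  obtain x y where "x \<in> V" "y \<in> V" "x \<noteq> y" "{u, v} = {x, y}"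
    using tree assms unfolding is_tree_def simple_graph_def by meson
  then show "u \<in> V" "v \<in> V" "u \<noteq> v"
    by (auto simp: doubleton_eq_iff)
qed

lemma edge_label: "{u, v} \<in> E \<Longrightarrow> l u > 0 \<or> l v > 0"
  using nondeg unfolding nondegenerate_labeling_def by (metis less_max_iff_disj)

lemma ex_path: "u \<in> V \<Longrightarrow> v \<in> V \<Longrightarrow> \<exists>p. joins V E u p v"
  using tree by (auto simp: is_tree_def graph_connected_def)

lemma d_eq_Max:
  assumes "joins V E u p v" "u \<noteq> v"
  shows "d u v = Max (l ` set p)"
proof -
  have "u \<in> V" "v \<in> V"
    using assms(1) walk_ends walk_subset by (fastforce simp: joins_iff_walk)+
  \<comment> \<open>Acyclicity makes the path unique, so the description denotes
    \<open>p\<close>.\<close>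
  moreover have "(THE p. joins V E u p v) = p"
    using assms(1) tree acyclic_path_unique[of V E u _ v p] unfolding is_tree_def
    by (intro the_equality) blast+
  ultimately show ?thesis
    using assms(2) by (simp add: label_dist_def)
qed

lemma label_le_d:
  assumes "joins V E u p v" "u \<noteq> v" "w \<in> set p"
  shows "l w \<le> d u v"
  using assms by (simp add: d_eq_Max)

lemma ends_le_d:
  assumes "u \<in> V" "v \<in> V" "u \<noteq> v"
  shows "l u \<le> d u v" "l v \<le> d u v"
proof -
  obtain p where "joins V E u p v"
    using ex_path assms by blast
  then show "l u \<le> d u v" "l v \<le> d u v"
    using assms(3) label_le_d walk_ends unfolding joins_iff_walk by metis+
qed

text \<open>The path lies inside the walk and its maximal label is attained. Distances can thus be
  bounded along any walk, without knowing the path.\<close>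

lemma d_witness:
  assumes "walk V E u p v" "u \<noteq> v"
  obtains w where "w \<in> set p" "d u v = l w"
proof -
  obtain q where q: "joins V E u q v" "set q \<subseteq> set p"
    using walk_contains_path assms(1) by metis
  have "q \<noteq> []"
    using q(1) by (simp add: joins_def graph_path_def)
  then have "Max (l ` set q) \<in> l ` set q"
    by simp
  with q assms(2) that show thesis
    by (auto simp: d_eq_Max)
qed

lemma d_edge:
  assumes "{u, v} \<in> E"
  shows "d u v = max (l u) (l v)"
proof -
  have "joins V E u [u, v] v"
    using assms edgeD by (auto simp: joins_def graph_path_def)
  then show ?thesis
    using edgeD(3)[OF assms] by (simp add: d_eq_Max)
qed

text \<open>The second vertex of the path serves. This gives positivity and isolation where
  \<open>l u = 0\<close> and the label of \<open>u\<close> itself yields no bound.\<close>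

lemma neighbour_le_d:
  assumes "u \<in> V" "v \<in> V" "u \<noteq> v"
  obtains w where "{w, u} \<in> E" "l w \<le> d u v"
proof -
  obtain p where p: "joins V E u p v"
    using ex_path assms by blast
  then obtain q where q: "p = u # q"
    by (cases p) (auto simp: joins_def graph_path_def)
  then have "q \<noteq> []"
    using p assms(3) by (auto simp: joins_def)
  then have "{u, hd q} \<in> E" "hd q \<in> set p"
    using p q by (auto simp: joins_iff_walk walk_Cons)
  then show thesis
    using that p assms(3) label_le_d by (metis insert_commute)
qed

section \<open>Metric axioms and the strong triangle inequality\<close>

lemma d_nonneg: "0 \<le> d u v"
proof (cases "u = v \<or> u \<notin> V \<or> v \<notin> V")
  case True
  then show ?thesis by (auto simp: label_dist_def)
next
  case False
  then show ?thesis using ends_le_d(1)[of u v] label_nonneg[of u] by auto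
qed

lemma d_pos:
  assumes "u \<in> V" "v \<in> V" "u \<noteq> v"
  shows "0 < d u v"
proof -
  obtain w where "{w, u} \<in> E" "l w \<le> d u v"
    using neighbour_le_d assms by blast
  \<comment> \<open>Both labels are at most \<open>d u v\<close>, and non-degeneracy makes one of
    them positive.\<close>
  then show ?thesis
    using edge_label[of w u] ends_le_d(1)[OF assms] by auto
qed

lemma d_commute: "d u v = d v u"
proof (cases "u = v \<or> u \<notin> V \<or> v \<notin> V")
  case True
  then show ?thesis by (auto simp: label_dist_def)
next
  case False
  then obtain p where p: "joins V E u p v"
    using ex_path by blast
  then have "joins V E v (rev p) u"
    by (auto simp: joins_iff_walk walk_rev)
  with p False show ?thesis
    using d_eq_Max[of u p v] d_eq_Max[of v "rev p" u] by auto
qed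

text \<open>The two paths through \<open>v\<close> form a walk from \<open>u\<close> to
  \<open>w\<close>, so the label attaining \<open>d u w\<close> lies on one of them.\<close>

lemma d_ultra:
  assumes "u \<in> V" "v \<in> V" "w \<in> V"
  shows "d u w \<le> max (d u v) (d v w)"
proof (cases "u = v \<or> v = w \<or> u = w")
  case True
  then show ?thesis using d_nonneg[of u v] by (auto simp: label_dist_def)
next
  case False
  obtain p q where pq: "joins V E u p v" "joins V E v q w"
    using ex_path assms by metis
  then have "walk V E u (p @ tl q) w"
    using walk_append by (metis joins_iff_walk)
  then obtain x where x: "x \<in> set (p @ tl q)" "d u w = l x"
    using d_witness False by metis
  have "q \<noteq> []"
    using pq(2) by (simp add: joins_def graph_path_def)
  then have "x \<in> set p \<or> x \<in> set q"
    using x(1) by (auto dest: list.set_sel(2))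
  then show ?thesis
    using x(2) pq False label_le_d by (metis le_max_iff_disj)
qed

sublocale Metric_space V d
proof
  show "d x z \<le> d x y + d y z" if "x \<in> V" "y \<in> V" "z \<in> V" for x y z
    using d_ultra[OF that] d_nonneg[of x y] d_nonneg[of y z] by linarith
  show "d x y = 0 \<longleftrightarrow> x = y" if "x \<in> V" "y \<in> V" for x y
    using d_pos[OF that] that by (auto simp: label_dist_def)
qed (fact d_nonneg d_commute)+

section \<open>Discreteness and total boundedness\<close>

lemma finite_net:
  assumes "mtotally_bounded V" "\<epsilon> > 0"
  shows "\<exists>K. finite K \<and> K \<subseteq> V \<and> (\<forall>v\<in>V. \<exists>x\<in>K. d x v < \<epsilon>)"
proof -
  have "\<exists>K. finite K \<and> K \<subseteq> V \<and> V \<subseteq> (\<Union>x\<in>K. mball x \<epsilon>)"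
    using assms by (simp add: mtotally_bounded_def)
  moreover have "V \<subseteq> (\<Union>x\<in>K. mball x \<epsilon>) \<Longrightarrow> \<forall>v\<in>V. \<exists>x\<in>K. d x v < \<epsilon>" for K
    by (auto dest!: subsetD)
  ultimately show ?thesis
    by metis
qed

lemma finite_large_labels:
  assumes "mtotally_bounded V" "\<epsilon> > 0"
  shows "finite {v \<in> V. l v \<ge> \<epsilon>}"
proof -
  obtain K where K: "finite K" "K \<subseteq> V" "\<forall>v\<in>V. \<exists>x\<in>K. d x v < \<epsilon>"
    using finite_net[OF assms] by blast
  have "v \<in> K" if v: "v \<in> V" "l v \<ge> \<epsilon>" for v
  proof -
    obtain x where x: "x \<in> K" "x \<in> V" "d x v < \<epsilon>"
      using K(2,3) v(1) by blast
    \<comment> \<open>Otherwise \<open>l v \<le> d x v < \<epsilon>\<close>.\<close>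
    then have "x = v"
      using ends_le_d(2)[of x v] v by force
    with x show ?thesis by simp
  qed
  then show ?thesis
    using K(1) finite_subset[of "{v \<in> V. l v \<ge> \<epsilon>}" K] by blast
qed

text \<open>The path from \<open>u\<close> to \<open>w\<close> passes through
  \<open>v\<close>.\<close>

lemma neighbours_separated:
  assumes "{u, v} \<in> E" "{w, v} \<in> E" "u \<noteq> w"
  shows "l v \<le> d u w"
proof -
  have "joins V E u [u, v, w] w"
    using assms edgeD[OF assms(1)] edgeD[OF assms(2)]
    by (auto simp: joins_def graph_path_def insert_commute)
  then show ?thesis
    using label_le_d assms(3) by simp
qed

lemma finite_neighbours:
  assumes "discrete_metric_space V d" "mtotally_bounded V" "v \<in> V"
  shows "finite {u \<in> V. {u, v} \<in> E}" (is "finite ?N")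
proof (cases "l v > 0")
  case True
  obtain K where K: "finite K" "K \<subseteq> V" "\<forall>u\<in>V. \<exists>x\<in>K. d x u < l v"
    using finite_net[OF assms(2) True] by blast
  from K(3) obtain f where f: "\<And>u. u \<in> V \<Longrightarrow> f u \<in> K \<and> d (f u) u < l v"
    by metis
  \<comment> \<open>Neighbours sharing a net point would be closer than \<open>l v\<close> by the
    strong triangle inequality, against \<open>neighbours_separated\<close>.\<close>
  have "inj_on f ?N"
  proof (intro inj_onI, rule ccontr)
    fix u w assume uw: "u \<in> ?N" "w \<in> ?N" "f u = f w" "u \<noteq> w"
    then have f: "f u \<in> V" "d (f u) u < l v" "d (f u) w < l v"
      using f[of u] f[of w] K(2) by auto
    have "d u w \<le> max (d u (f u)) (d (f u) w)"
      using uw f(1) by (intro d_ultra) auto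
    also have "\<dots> < l v"
      using f(2,3) d_commute[of u "f u"] by simp
    finally show False
      using neighbours_separated[of u v w] uw by auto
  qed
  moreover have "f ` ?N \<subseteq> K"
    using f by auto
  ultimately show ?thesis
    using K(1) inj_on_finite by blast
next
  case False
  then have "l v = 0"
    using label_nonneg assms(3) by force
  obtain r where r: "r > 0" "mball v r = {v}"
    using assms(1,3) by (auto simp: discrete_metric_space_def)
  \<comment> \<open>As \<open>l v = 0\<close>, a neighbour's distance from \<open>v\<close> is its
    own label, and isolation keeps it at least \<open>r\<close>.\<close>
  have "?N \<subseteq> {u \<in> V. l u \<ge> r}"
  proof clarify
    fix u assume u: "u \<in> V" "{u, v} \<in> E"
    then have "u \<notin> mball v r"
      using r(2) edgeD by auto
    then have "r \<le> d u v"
      using u(1) assms(3) d_commute[of u v] by simp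
    then show "l u \<ge> r"
      using d_edge[OF u(2)] \<open>l v = 0\<close> r(1) by auto
  qed
  then show ?thesis
    using finite_large_labels[OF assms(2) r(1)] finite_subset by blast
qed

section \<open>Discreteness and total boundedness from finiteness\<close>

lemma discrete_if_locally_finite:
  assumes "locally_finite_graph V E"
  shows "discrete_metric_space V d"
  unfolding discrete_metric_space_def
proof
  fix x assume x: "x \<in> V"
  have ball: "mball x r = {x}" if "r > 0" "\<And>y. y \<in> V \<Longrightarrow> y \<noteq> x \<Longrightarrow> r \<le> d x y" for r
    using that x by force
  show "\<exists>r>0. mball x r = {x}"
  \<comment> \<open>A positive label of \<open>x\<close> bounds all distances from \<open>x\<close>
    below and serves as radius. Otherwise a lower bound for the neighbours' labels does, since every
    nontrivial path from \<open>x\<close> meets a neighbour.\<close>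
  proof (cases "l x > 0")
    case True
    then show ?thesis
      using ball[of "l x"] ends_le_d(1) x by metis
  next
    case False
    let ?N = "{u \<in> V. {u, x} \<in> E}"
    (* The 1 keeps the set nonempty when x is the only vertex. *)
    define r where "r = Min (insert 1 (l ` ?N))"
    have fin: "finite ?N"
      using assms x by (simp add: locally_finite_graph_def)
    \<comment> \<open>As \<open>l x\<close> is not positive, non-degeneracy makes every neighbour's
      label positive, and there are finitely many.\<close>
    have "r > 0"
      using fin False edge_label by (auto simp: r_def)
    moreover have "r \<le> d x y" if y: "y \<in> V" "y \<noteq> x" for y
    proof -
      obtain w where w: "{w, x} \<in> E" "l w \<le> d x y"
        using neighbour_le_d x y by metis
      then have "r \<le> l w"
        using fin edgeD(1)[OF w(1)] by (auto simp: r_def intro!: Min_le)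
      with w(2) show ?thesis by simp
    qed
    ultimately show ?thesis
      using ball by blast
  qed
qed

text \<open>Starting outside \<open>K\<close>, stop at the first vertex in \<open>K\<close>. Earlier
  vertices have small labels because they are not in \<open>K\<close>; the last one does because its
  predecessor would otherwise be in \<open>K\<close> as a neighbour of a large label.\<close>

lemma walk_small_labels_to_net:
  assumes "walk V E v p r" "r \<in> K"
    and "\<And>u. u \<in> V \<Longrightarrow> l u \<ge> \<epsilon> \<Longrightarrow> u \<in> K"
    and "\<And>u w. {u, w} \<in> E \<Longrightarrow> l w \<ge> \<epsilon> \<Longrightarrow> u \<in> K"
  shows "v \<in> K \<or> (\<exists>k\<in>K. \<exists>q. walk V E v q k \<and> (\<forall>w\<in>set q. l w < \<epsilon>))"
  using assms(1)
proof (induction p arbitrary: v)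
  case Nil
  then show ?case by (simp add: walk_def)
next
  case (Cons x p)
  show ?case
  \<comment> \<open>If \<open>p\<close> is empty, then \<open>v = r\<close>, which lies in
    \<open>K\<close>.\<close>
  proof (cases "p = [] \<or> v \<in> K")
    case True
    with Cons.prems assms(2) show ?thesis by auto
  next
    case False
    then have w: "x \<in> V" "v = x" "{x, hd p} \<in> E" "walk V E (hd p) p r"
      using Cons.prems by (auto simp: walk_Cons)
    have small: "l x < \<epsilon>" "l (hd p) < \<epsilon>"
      using False w assms(3)[of x] assms(4)[of x "hd p"] by (auto simp: not_le[symmetric])
    obtain k q where kq: "k \<in> K" "walk V E (hd p) q k" "\<forall>w\<in>set q. l w < \<epsilon>"
    proof (cases "hd p \<in> K")
      case True
      with that[of "hd p" "[hd p]"] small(2) edgeD(2)[OF w(3)] show thesis by simp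
    next
      case False
      with Cons.IH[OF w(4)] that show thesis by blast
    qed
    then have "q \<noteq> []" "hd q = hd p"
      by (auto simp: walk_def)
    with kq w have "walk V E v (x # q) k"
      by (simp add: walk_Cons)
    with kq small(1) show ?thesis
      by (metis set_ConsD)
  qed
qed

lemma totally_bounded_if_finite:
  assumes "locally_finite_graph V E" "\<And>\<epsilon>. \<epsilon> > 0 \<Longrightarrow> finite {v \<in> V. l v \<ge> \<epsilon>}"
  shows "mtotally_bounded V"
  unfolding mtotally_bounded_def
proof (intro allI impI)
  fix \<epsilon> :: real assume \<epsilon>: "\<epsilon> > 0"
  obtain r where r: "r \<in> V"
    using tree by (auto simp: is_tree_def)
  let ?L = "{v \<in> V. l v \<ge> \<epsilon>}"
  \<comment> \<open>The root \<open>r\<close> gives every walk a target in \<open>K\<close> even if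
    no label reaches \<open>\<epsilon>\<close>; the neighbours ensure that a walk enters
    \<open>K\<close> from outside at a small label.\<close>
  define K where "K = insert r (?L \<union> (\<Union>w\<in>?L. {u \<in> V. {u, w} \<in> E}))"
  have "finite K"
    using assms(1) assms(2)[OF \<epsilon>] by (auto simp: K_def locally_finite_graph_def)
  moreover have "K \<subseteq> V"
    using r by (auto simp: K_def)
  moreover have "\<exists>k\<in>K. v \<in> mball k \<epsilon>" if v: "v \<in> V" for v
  proof (cases "v \<in> K")
    case True
    then show ?thesis using v \<epsilon> by (auto intro!: bexI[of _ v])
  next
    case False
    obtain p where "walk V E v p r"
      using ex_path[OF v r] by (auto simp: joins_iff_walk)
    moreover have "r \<in> K" "\<And>u. u \<in> V \<Longrightarrow> l u \<ge> \<epsilon> \<Longrightarrow> u \<in> K"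
      "\<And>u w. {u, w} \<in> E \<Longrightarrow> l w \<ge> \<epsilon> \<Longrightarrow> u \<in> K"
      unfolding K_def using edgeD(1,2) by blast+
    ultimately obtain k q where k: "k \<in> K" "walk V E v q k" "\<forall>w\<in>set q. l w < \<epsilon>"
      using walk_small_labels_to_net[of v p r K \<epsilon>] False by blast
    \<comment> \<open>\<open>v\<close> is outside \<open>K\<close>, hence distinct from
      \<open>k\<close>, and the distance is the label of a vertex of \<open>q\<close>.\<close>
    then have "d v k < \<epsilon>"
      using d_witness[OF k(2)] False by metis
    then show ?thesis
      using k(1) \<open>K \<subseteq> V\<close> v by (auto simp: d_commute)
  qed
  ultimately show "\<exists>K. finite K \<and> K \<subseteq> V \<and> V \<subseteq> (\<Union>x\<in>K. mball x \<epsilon>)"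
    by (intro exI[of _ K]) (simp add: subset_iff)
qed

end

theorem theorem4p17:
  fixes V :: "'a set" and E :: "'a set set" and l :: "'a \<Rightarrow> real"
  assumes "is_tree V E"
    and "\<forall>v\<in>V. 0 \<le> l v"
    and "nondegenerate_labeling E l"
  shows "(discrete_metric_space V (label_dist V E l) \<and>
          Metric_space.mtotally_bounded V (label_dist V E l) V)
     \<longleftrightarrow> (locally_finite_graph V E \<and> (\<forall>\<epsilon>>0. finite {v \<in> V. l v \<ge> \<epsilon>}))"
proof -
  interpret labeled_tree V E l
    using assms by unfold_locales auto
  show ?thesis
  proof (intro iffI conjI allI impI; elim conjE)
    assume *: "discrete_metric_space V d" "mtotally_bounded V"
    show "locally_finite_graph V E"
      using finite_neighbours[OF *] by (simp add: locally_finite_graph_def)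
    show "finite {v \<in> V. l v \<ge> \<epsilon>}" if "\<epsilon> > 0" for \<epsilon>
      using finite_large_labels[OF *(2) that] .
  next
    assume "locally_finite_graph V E" "\<forall>\<epsilon>>0. finite {v \<in> V. l v \<ge> \<epsilon>}"
    then show "discrete_metric_space V d" "mtotally_bounded V"
      using discrete_if_locally_finite totally_bounded_if_finite by simp_all
  qed
qed

end
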